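(* Every graph $G$ (finite or infinite, of arbitrary cardinality) is majority $3$-choosable: for every assignment of lists $L(v)$, $v\in V(G)$, each consisting of exactly $3$ colours, there is a majority colouring $g$ of $G$ with $g(v)\in L(v)$ for every vertex $v$.
   Context: A colouring $g$ of the vertices of a graph $G$ is a majority colouring if for every vertex $v$, the number (cardinality) of neighbours $u$ of $v$ with $g(u)=g(v)$ is at most the number (cardinality) of neighbours $u$ of $v$ with $g(u)\neq g(v)$. A graph is majority $\ell$-choosable if for every system of lists $\{L(v): v\in V(G)\}$ with $|L(v)|=\ell$ for all $v$ there is a majority colouring $g$ with $g(v)\in L(v)$ for all $v$. *)

theory Defs
  imports Main "HOL-Library.Equipollence"
begin

definition simple_graph :: "'a set \<Rightarrow> 'a set set \<Rightarrow> bool" where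
  "simple_graph V E \<longleftrightarrow> E \<subseteq> {e. e \<subseteq> V \<and> card e = 2}"

definition neighbours :: "'a set set \<Rightarrow> 'a \<Rightarrow> 'a set" where
  "neighbours E v = {u. {u, v} \<in> E}"

(* The two numbers of neighbours are compared as cardinals, i.e. by existence of an injection;
   comparing them with card would be wrong at vertices of infinite degree. *)
definition majority_colouring :: "'a set \<Rightarrow> 'a set set \<Rightarrow> ('a \<Rightarrow> 'c) \<Rightarrow> bool" where
  "majority_colouring V E g \<longleftrightarrow>
     (\<forall>v\<in>V. {u \<in> neighbours E v. g u = g v} \<lesssim> {u \<in> neighbours E v. g u \<noteq> g v})"

(* The type from which colours are taken is an explicit (phantom) argument, since it does not
   occur in the graph; theorems about all lists are to be stated for an arbitrary type 'c. *)
definition majority_choosable :: "'c itself \<Rightarrow> nat \<Rightarrow> 'a set \<Rightarrow> 'a set set \<Rightarrow> bool" where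
  "majority_choosable _ l V E \<longleftrightarrow>
     (\<forall>L :: 'a \<Rightarrow> 'c set. (\<forall>v\<in>V. finite (L v) \<and> card (L v) = l) \<longrightarrow>
        (\<exists>g. majority_colouring V E g \<and> (\<forall>v\<in>V. g v \<in> L v)))"

end

theory Submission
  imports Defs "HOL-Analysis.Function_Topology"
begin

text \<open>
  Let \<open>F\<close> be the set of vertices of finite degree. There are a well-founded relation \<open>R\<close> on the
  vertices and a function \<open>f\<close> such that every vertex \<open>w\<close> of infinite degree \<open>d\<close> has either \<open>d\<close>
  neighbours outside \<open>F\<close> that precede it in \<open>R\<close>, or \<open>d\<close> neighbours \<open>u\<close> with \<open>f u = w\<close> which lie
  in \<open>F\<close> or succeed \<open>w\<close> in \<open>R\<close>. Colour the vertices outside \<open>F\<close> greedily along \<open>R\<close>, where \<open>w\<close> avoids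
  the colour of \<open>f w\<close> and, in the first case, the at most one colour borne by all but fewer than
  \<open>d\<close> of its early neighbours: three colours suffice. On \<open>F\<close>, drop the colour of \<open>f u\<close> from the
  list of \<open>u\<close>; from the two remaining colours a majority colouring is obtained by minimising the
  number of monochromatic edges, and by compactness if \<open>F\<close> is infinite.

  The pair \<open>(R, f)\<close> is constructed by induction on the number \<open>\<kappa>\<close> of vertices. If \<open>\<kappa>\<close> is
  uncountable, exhaust the graph by a chain of sets of size less than \<open>\<kappa>\<close>, each closed under the
  neighbourhoods that are not larger than its index. Consider a vertex of a block (a difference of
  consecutive sets). If its neighbourhood is small, then it lies in the current set, and most of it is
  in earlier blocks or in the same block, where the induction hypothesis applies. If it is large, then
  the vertex receives one value \<open>f u = w\<close> in each of sufficiently many later blocks; as each block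
  contains at most one such \<open>u\<close>, this does not spoil the induction hypothesis.
\<close>

unbundle cardinal_syntax

section \<open>Cardinal bounds and well-orders with small initial segments\<close>

lemma card_of_not_ordLeq: "\<not> |A| \<le>o |B| \<longleftrightarrow> |B| <o |A|"
  by (intro not_ordLeq_iff_ordLess card_of_Well_order)

lemma card_of_Un_bound:
  assumes "infinite C" "|A| \<le>o |C|" "|B| \<le>o |C|"
  shows "|A \<union> B| \<le>o |C|"
  using card_of_Un_ordLeq_infinite_Field[of "|C|"] assms by (simp add: Field_card_of card_of_card_order_on)

lemma card_of_insert_bound:
  assumes "infinite C" "|A| \<le>o |C|"
  shows "|insert a A| \<le>o |C|"
proof -
  have "C \<noteq> {}" using assms by auto
  then show ?thesis
    using card_of_Un_bound[OF assms(1) card_of_singl_ordLeq assms(2), of a] by simp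
qed

text \<open>\<open>K b\<close> is the set of predecessors of \<open>b\<close>, padded by the naturals so that it is always infinite.\<close>

lemma well_order_small_segments:
  fixes U :: "'a set"
  assumes unc: "|UNIV :: nat set| <o |U|"
  obtains lt :: "'a rel" and K :: "'a \<Rightarrow> ('a + nat) set" where
    "wf lt" "trans lt" "lt \<subseteq> U \<times> U"
    "\<And>a b. a \<in> U \<Longrightarrow> b \<in> U \<Longrightarrow> (a, b) \<in> lt \<or> a = b \<or> (b, a) \<in> lt"
    "\<And>b. infinite (K b)" "\<And>b. b \<in> U \<Longrightarrow> |K b| <o |U|"
    "\<And>b. |{a. (a, b) \<in> lt}| \<le>o |K b|"
    "\<And>a b. (a, b) \<in> lt \<Longrightarrow> |K a| \<le>o |K b|"
    "\<And>b (Y :: 'a set). b \<in> U \<Longrightarrow> |Y| \<le>o |U| \<Longrightarrow> |K b| <o |Y| \<Longrightarrow>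
       |Y| \<le>o |{c \<in> U. (b, c) \<in> lt \<and> |K c| <o |Y|}|"
proof -
  \<comment> \<open>The order \<open>|U|\<close> is an initial ordinal, so each of its proper
    initial segments is smaller than \<open>U\<close>.\<close>
  define r where "r = |U|"
  define lt where "lt = r - Id"
  define K :: "'a \<Rightarrow> ('a + nat) set" where "K = (\<lambda>b. {a. (a, b) \<in> lt} <+> UNIV)"
  have wo: "well_order_on U r"
    unfolding r_def by (rule card_of_well_order_on)
  have co: "Card_order r" and Fr: "Field r = U"
    unfolding r_def using card_of_Card_order[of U] by (simp_all add: Field_card_of)
  have infU: "infinite U"
    using unc infinite_iff_card_of_nat ordLess_imp_ordLeq by blast
  have wf: "wf lt"
    using wo unfolding lt_def well_order_on_def by blast
  have lin: "linear_order_on U r"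
    using wo unfolding well_order_on_def by blast
  have sub: "lt \<subseteq> U \<times> U"
    unfolding lt_def using Fr by (auto simp: Field_def)
  have tr: "trans lt"
    using lin unfolding lt_def linear_order_on_def partial_order_on_def preorder_on_def
    by (auto intro: trans_diff_Id)
  have tot: "(a, b) \<in> lt \<or> a = b \<or> (b, a) \<in> lt" if "a \<in> U" "b \<in> U" for a b
    using lin that unfolding lt_def linear_order_on_def total_on_def by auto
  have seg: "{a. (a, b) \<in> lt} = underS r b" for b
    unfolding lt_def underS_def by auto
  have infK: "infinite (K b)" for b
    unfolding K_def by simp
  have KU: "|K b| <o |U|" if "b \<in> U" for b
    unfolding K_def seg
    using card_of_Plus_ordLess_infinite[OF infU _ unc] card_of_underS[OF co] that Fr r_def by metis
  have segK: "|{a. (a, b) \<in> lt}| \<le>o |K b|" for b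
    unfolding K_def by (rule card_of_Plus1)
  have Kmono: "|K a| \<le>o |K b|" if "(a, b) \<in> lt" for a b
    unfolding K_def by (rule card_of_Plus_mono1, rule card_of_mono1) (use that tr in \<open>auto dest: transD\<close>)
  have many: "|Y| \<le>o |{c \<in> U. (b, c) \<in> lt \<and> |K c| <o |Y|}|"
    if b: "b \<in> U" and YU: "|Y| \<le>o |U|" and bY: "|K b| <o |Y|" for b and Y :: "'a set"
  proof -
    define W where "W = {c \<in> U. |K c| <o |Y|}"
    define B where "B = {c \<in> U. (b, c) \<in> lt \<and> |K c| <o |Y|}"
    have infY: "infinite Y"
      using bY infK card_of_ordLeq_infinite ordLess_imp_ordLeq by blast
    have natY: "|UNIV :: nat set| <o |Y|"
      using bY infK[of b] infinite_iff_card_of_nat ordLeq_ordLess_trans by blast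
    have down: "a \<in> W" if "c \<in> W" "(a, c) \<in> lt" for a c
      using that sub Kmono ordLeq_ordLess_trans unfolding W_def by blast
    have "|Y| \<le>o |W|"
    proof (rule ccontr)
      assume "\<not> |Y| \<le>o |W|"
      then have WY: "|W| <o |Y|"
        by (simp add: card_of_not_ordLeq)
      then have "|W| <o |U|"
        using YU ordLess_ordLeq_trans by blast
      then have "\<not> U \<subseteq> W"
        using card_of_mono1 not_ordLess_ordLeq by blast
      \<comment> \<open>\<open>W\<close> is downward closed, so the least element outside
        \<open>W\<close> has exactly \<open>W\<close> as its set of predecessors. Smallness of
        \<open>W\<close> then puts this element into \<open>W\<close>.\<close>
      then obtain c where c: "c \<in> U - W" and min: "\<And>a. (a, c) \<in> lt \<Longrightarrow> a \<notin> U - W"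
        using wfE_min[OF wf, of _ "U - W"] by blast
      have "{a. (a, c) \<in> lt} = W"
      proof
        show "{a. (a, c) \<in> lt} \<subseteq> W"
          using min sub by blast
        show "W \<subseteq> {a. (a, c) \<in> lt}"
          using c tot down unfolding W_def by blast
      qed
      then have "|K c| <o |Y|"
        unfolding K_def using card_of_Plus_ordLess_infinite[OF infY WY natY] by simp
      then show False
        using c unfolding W_def by blast
    qed
    moreover have "W \<subseteq> B \<union> insert b {a. (a, b) \<in> lt}"
      using tot b unfolding W_def B_def by blast
    ultimately have le: "|Y| \<le>o |B \<union> insert b {a. (a, b) \<in> lt}|"
      using card_of_mono1 ordLeq_transitive by blast
    \<comment> \<open>The elements up to \<open>b\<close> are fewer than \<open>Y\<close>, so
      discarding them from \<open>W\<close> does not affect the bound.\<close>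
    have "|insert b {a. (a, b) \<in> lt}| <o |Y|"
      using card_of_insert_bound[OF infK segK] bY ordLeq_ordLess_trans by blast
    then have "\<not> |B| <o |Y|"
      using card_of_Un_ordLess_infinite[OF infY] le not_ordLess_ordLeq by blast
    then show ?thesis
      unfolding B_def using card_of_not_ordLeq by blast
  qed
  show thesis
    by (rule that[of lt K]) (fact wf tr sub tot infK KU segK Kmono many)+
qed

section \<open>Filtrations by small closed sets\<close>

text \<open>Each of the countably many iterates of \<open>\<rho>\<close> multiplies the size by at
  most \<open>|B|\<close>, which an infinite \<open>B\<close> absorbs, and so is the countable
  union.\<close>

lemma card_of_closure:
  assumes inf: "infinite B" and AB: "|A| \<le>o |B|" and step: "\<And>x. |\<rho> `` {x}| \<le>o |B|"
  shows "|\<rho>\<^sup>* `` A| \<le>o |B|"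
proof -
  have pow: "|(\<rho> ^^ n) `` A| \<le>o |B|" for n
  proof (induction n)
    case 0
    then show ?case using AB by simp
  next
    case (Suc n)
    have "(\<rho> ^^ Suc n) `` A = (\<Union>x \<in> (\<rho> ^^ n) `` A. \<rho> `` {x})"
      by auto
    then show ?case
      using card_of_UNION_ordLeq_infinite[OF inf Suc, of "\<lambda>x. \<rho> `` {x}"] step by simp
  qed
  have "\<rho>\<^sup>* `` A = (\<Union>n. (\<rho> ^^ n) `` A)"
    by (simp add: rtrancl_is_UN_relpow Image_def) blast
  then show ?thesis
    using card_of_UNION_ordLeq_infinite[OF inf, of "UNIV :: nat set" "\<lambda>n. (\<rho> ^^ n) `` A"]
      inf infinite_iff_card_of_nat[of B] pow by auto
qed

text \<open>
  Stage \<open>(b, v)\<close> of this lexicographic recursion is active only if \<open>v\<close> is \<open>b\<close> or has appeared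
  before \<open>b\<close>. It adds \<open>b\<close> and one new neighbour \<open>p (b, v)\<close> of \<open>v\<close>, and closes under the
  neighbourhoods of size at most \<open>|K b|\<close>. Inactive stages get the empty set, so only \<open>|K b|\<close>
  stages up to \<open>(b, v)\<close> contribute elements. A vertex of degree larger than \<open>|K b|\<close> thus gets a
  private neighbour at every later stage at which its neighbourhood is not yet exhausted.
\<close>

lemma closed_filtration:
  fixes U :: "'a set" and lt :: "'a rel" and K :: "'a \<Rightarrow> 'b set" and M :: "'a \<Rightarrow> 'a set"
  assumes wf: "wf lt" and tr: "trans lt" and sub: "lt \<subseteq> U \<times> U"
    and infK: "\<And>b. infinite (K b)"
    and segK: "\<And>b. |{a. (a, b) \<in> lt}| \<le>o |K b|"
    and Kmono: "\<And>a b. (a, b) \<in> lt \<Longrightarrow> |K a| \<le>o |K b|"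
    and M: "\<And>x. M x \<subseteq> U"
  obtains X :: "'a \<times> 'a \<Rightarrow> 'a set" and p :: "'a \<times> 'a \<Rightarrow> 'a" where
    "\<And>b v. |X (b, v)| \<le>o |K b|"
    "\<And>x b v. x \<in> X (b, v) \<Longrightarrow> x \<in> U \<and> b \<in> U \<and> v \<in> U"
    "\<And>b. b \<in> U \<Longrightarrow> b \<in> X (b, b)"
    "\<And>x b v. x \<in> X (b, v) \<Longrightarrow> |M x| \<le>o |K b| \<Longrightarrow> M x \<subseteq> X (b, v)"
    "\<And>b v c w. w \<in> X (b, v) \<Longrightarrow> (b, c) \<in> lt \<Longrightarrow> |K c| <o |M w| \<Longrightarrow>
       p (c, w) \<in> M w \<inter> X (c, w) - \<Union> (X ` {j. (j, (c, w)) \<in> lt <*lex*> lt})"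
proof -
  define lx where "lx = lt <*lex*> lt"
  define \<rho> where "\<rho> = (\<lambda>b. {(x, y). y \<in> M x \<and> |M x| \<le>o |K b|})"
  define prev where "prev = (\<lambda>(f :: 'a \<times> 'a \<Rightarrow> 'a set) j. \<Union> (f ` {i. (i, j) \<in> lx}))"
  define below where "below = (\<lambda>(f :: 'a \<times> 'a \<Rightarrow> 'a set) b. \<Union> (f ` {(c, v). (c, b) \<in> lt}))"
  \<comment> \<open>The default \<open>fst j\<close> is harmless: the stage contains this element
    anyway.\<close>
  define pick where "pick = (\<lambda>Z (j :: 'a \<times> 'a).
    if M (snd j) \<subseteq> Z then fst j else SOME u. u \<in> M (snd j) - Z)"
  define H where "H = (\<lambda>f j. if fst j \<in> U \<and> snd j \<in> insert (fst j) (below f (fst j))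
    then (\<rho> (fst j))\<^sup>* `` (prev f j \<union> {fst j, pick (prev f j) j}) else {})"
  define X where "X = wfrec lx H"
  define p where "p = (\<lambda>j. pick (prev X j) j)"
  have wflx: "wf lx"
    unfolding lx_def using wf by (intro wf_lex_prod)
  \<comment> \<open>\<open>prev\<close> and \<open>below\<close> consult only stages strictly
    earlier in \<open>lx\<close>, so cutting \<open>X\<close> off at \<open>j\<close> does not
    change them.\<close>
  have X_H: "X j = H X j" for j
  proof -
    have "prev (cut X lx j) j = prev X j"
      unfolding prev_def by (auto simp: cut_apply)
    moreover have "below (cut X lx j) (fst j) = below X (fst j)"
      unfolding below_def by (cases j) (force simp: cut_apply lx_def)
    ultimately have "H (cut X lx j) j = H X j"
      unfolding H_def by (simp only:)
    moreover have "X j = H (cut X lx j) j"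
      unfolding X_def by (rule wfrec[OF wflx])
    ultimately show ?thesis
      by simp
  qed
  have X: "X (b, v) = (\<rho> b)\<^sup>* `` (prev X (b, v) \<union> {b, p (b, v)})"
    if "b \<in> U" "v \<in> insert b (below X b)" for b v
    unfolding X_H[of "(b, v)"] using that by (simp add: H_def p_def)
  have X_empty: "X (b, v) = {}" if "\<not> (b \<in> U \<and> v \<in> insert b (below X b))" for b v
    unfolding X_H[of "(b, v)"] using that unfolding H_def by auto
  have in_dom: "b \<in> U \<and> v \<in> insert b (below X b)" if "x \<in> X (b, v)" for x b v
    using X_empty that by blast

  have below_iff: "x \<in> below X c \<longleftrightarrow> (\<exists>a v. (a, c) \<in> lt \<and> x \<in> X (a, v))" for x c
    unfolding below_def by auto

  have XU: "X j \<subseteq> U" for j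
  proof (induction j rule: wf_induct_rule[OF wflx])
    case (1 j)
    obtain b v where j: "j = (b, v)" by (cases j)
    show ?case
    proof (cases "b \<in> U \<and> v \<in> insert b (below X b)")
      case True
      have "pick Z (b, v) \<in> U" for Z
        unfolding pick_def using M[of v] True someI_ex[of "\<lambda>u. u \<in> M v - Z"] by auto
      then have "prev X j \<union> {b, p (b, v)} \<subseteq> U"
        using 1 True unfolding prev_def p_def by auto
      moreover have "y \<in> U" if "(x, y) \<in> (\<rho> b)\<^sup>*" "x \<in> U" for x y
        using that M by (induction rule: rtrancl_induct) (auto simp: \<rho>_def)
      ultimately show ?thesis
        unfolding j using X True by (auto simp: j)
    next
      case False
      then show ?thesis using X_empty j by simp
    qed
  qed

  have bound: "\<forall>v. |X (b, v)| \<le>o |K b|" for b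
  proof (induction b rule: wf_induct_rule[OF wf])
    case (1 b)
    note IH = 1
    \<comment> \<open>Stages \<open>(a, v)\<close> with \<open>v\<close> outside
      \<open>insert a (below X a)\<close> are empty. The inner induction bounds this index set for
      every \<open>a\<close> before \<open>c\<close>, and the outer one bounds each stage.\<close>
    have below_K: "|below X c| \<le>o |K b|" if "c = b \<or> (c, b) \<in> lt" for c
      using that
    proof (induction c rule: wf_induct_rule[OF wf])
      case (1 c)
      have cb: "(a, b) \<in> lt" if "(a, c) \<in> lt" for a
        using transD[OF tr that] 1(2) that by blast
      have segc: "|{a. (a, c) \<in> lt}| \<le>o |K b|"
        by (rule ordLeq_transitive[OF card_of_mono1 segK]) (use cb in blast)
      have ins: "|insert a (below X a)| \<le>o |K b|" if "(a, c) \<in> lt" for a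
        by (rule card_of_insert_bound[OF infK 1(1)[OF that disjI2[OF cb[OF that]]]])
      have idx: "|SIGMA a : {a. (a, c) \<in> lt}. insert a (below X a)| \<le>o |K b|"
        by (rule card_of_Sigma_ordLeq_infinite[OF infK segc]) (simp add: ins)
      have "below X c \<subseteq> \<Union> (X ` (SIGMA a : {a. (a, c) \<in> lt}. insert a (below X a)))"
      proof
        fix x assume "x \<in> below X c"
        then obtain a v where "(a, c) \<in> lt" "x \<in> X (a, v)"
          unfolding below_iff by blast
        then show "x \<in> \<Union> (X ` (SIGMA a : {a. (a, c) \<in> lt}. insert a (below X a)))"
          using in_dom[of x a v] by blast
      qed
      moreover have "|\<Union> (X ` (SIGMA a : {a. (a, c) \<in> lt}. insert a (below X a)))| \<le>o |K b|"
      proof (rule card_of_UNION_ordLeq_infinite[OF infK idx], rule ballI)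
        fix i assume "i \<in> (SIGMA a : {a. (a, c) \<in> lt}. insert a (below X a))"
        then obtain a v where i: "i = (a, v)" "(a, c) \<in> lt" by auto
        then have "|X (a, v)| \<le>o |K a|" "|K a| \<le>o |K b|"
          using IH[OF cb] Kmono[OF cb] by blast+
        then show "|X i| \<le>o |K b|"
          unfolding i(1) by (rule ordLeq_transitive)
      qed
      ultimately show ?case
        using card_of_mono1 ordLeq_transitive by blast
    qed
    have "|X (b, v)| \<le>o |K b|" for v
    proof (induction v rule: wf_induct_rule[OF wf])
      case (1 v)
      show ?case
      proof (cases "b \<in> U \<and> v \<in> insert b (below X b)")
        case True
        \<comment> \<open>These are the only possibly nonempty stages before \<open>(b, v)\<close>
          with the same first coordinate \<open>b\<close>; all other earlier ones are covered by
          \<open>below X b\<close>.\<close>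
        define S where "S = {a \<in> insert b (below X b). (a, v) \<in> lt}"
        have "|S| \<le>o |K b|"
          using card_of_mono1[of S "insert b (below X b)"] card_of_insert_bound[OF infK below_K]
          unfolding S_def by (blast intro: ordLeq_transitive)
        then have "|\<Union>a\<in>S. X (b, a)| \<le>o |K b|"
          by (rule card_of_UNION_ordLeq_infinite[OF infK]) (use 1 S_def in blast)
        then have "|below X b \<union> (\<Union>a\<in>S. X (b, a))| \<le>o |K b|"
          by (intro card_of_Un_bound[OF infK] below_K) auto
        moreover have "prev X (b, v) \<subseteq> below X b \<union> (\<Union>a\<in>S. X (b, a))"
        proof
          fix x assume "x \<in> prev X (b, v)"
          then obtain c a where "(c, b) \<in> lt \<or> c = b \<and> (a, v) \<in> lt" "x \<in> X (c, a)"
            unfolding prev_def lx_def by auto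
          then show "x \<in> below X b \<union> (\<Union>a\<in>S. X (b, a))"
          proof (elim disjE)
            assume "(c, b) \<in> lt"
            then have "x \<in> below X b"
              using \<open>x \<in> X (c, a)\<close> below_iff by blast
            then show ?thesis ..
          next
            assume "c = b \<and> (a, v) \<in> lt"
            then have "a \<in> S" "x \<in> X (b, a)"
              using \<open>x \<in> X (c, a)\<close> in_dom[of x c a] unfolding S_def by simp_all
            then show ?thesis by (intro UnI2 UN_I)
          qed
        qed
        ultimately have "|prev X (b, v)| \<le>o |K b|"
          using card_of_mono1 ordLeq_transitive by blast
        then have "|prev X (b, v) \<union> {b, p (b, v)}| \<le>o |K b|"
          by (simp add: card_of_insert_bound[OF infK])
        moreover have "|\<rho> b `` {x}| \<le>o |K b|" for x
          by (cases "|M x| \<le>o |K b|") (simp_all add: \<rho>_def Image_def card_of_empty)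
        ultimately show ?thesis
          unfolding X[OF conjunct1[OF True] conjunct2[OF True]] by (intro card_of_closure[OF infK])
      next
        case False
        then show ?thesis using X_empty[of b v] card_of_empty by simp
      qed
    qed
    then show ?case by blast
  qed
  have prev_bound: "|prev X (b, v)| \<le>o |K b|" if "b \<in> U" "v \<in> insert b (below X b)" for b v
  proof -
    have "prev X (b, v) \<subseteq> X (b, v)"
      using X[OF that] by auto
    then show ?thesis
      using bound card_of_mono1 ordLeq_transitive by blast
  qed
  have below_U: "below X b \<subseteq> U" for b
    using XU below_iff by blast
  show thesis
  proof (rule that)
    show "|X (b, v)| \<le>o |K b|" for b v
      using bound by blast
    show "x \<in> U \<and> b \<in> U \<and> v \<in> U" if "x \<in> X (b, v)" for x b v
      using in_dom[OF that] that XU below_U by blast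
    show "b \<in> X (b, b)" if "b \<in> U" for b
      using X[of b b] that by auto
    show "M x \<subseteq> X (b, v)" if "x \<in> X (b, v)" "|M x| \<le>o |K b|" for x b v
    proof
      fix y assume "y \<in> M x"
      then have "(x, y) \<in> \<rho> b"
        using that unfolding \<rho>_def by simp
      then show "y \<in> X (b, v)"
        using that(1) X in_dom[OF that(1)] by (auto intro: rtrancl_into_rtrancl)
    qed
    show "p (c, w) \<in> M w \<inter> X (c, w) - \<Union> (X ` {j. (j, (c, w)) \<in> lt <*lex*> lt})"
      if w: "w \<in> X (b, v)" and bc: "(b, c) \<in> lt" and big: "|K c| <o |M w|" for b v c w
    proof -
      have dom: "c \<in> U" "w \<in> insert c (below X c)"
        using sub bc w below_iff by blast+
      \<comment> \<open>All earlier stages together have at most \<open>|K c|\<close> elements, so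
        they cannot exhaust \<open>M w\<close> and \<open>pick\<close> does not fall back on its
        default.\<close>
      have "\<not> M w \<subseteq> prev X (c, w)"
        using prev_bound[OF dom] big card_of_mono1 ordLeq_transitive not_ordLess_ordLeq by blast
      then have "p (c, w) \<in> M w - prev X (c, w)"
        unfolding p_def pick_def using someI_ex[of "\<lambda>u. u \<in> M w - prev X (c, w)"] by auto
      moreover have "p (c, w) \<in> X (c, w)"
        using X[OF dom] by auto
      ultimately show ?thesis
        unfolding prev_def lx_def by blast
    qed
  qed
qed

section \<open>Well-founded relations with many promises or many early neighbours\<close>

text \<open>
  \<open>f u\<close> is the vertex whose colour \<open>u\<close> promises to avoid; the vertices of \<open>F\<close> are coloured last,
  so they may make promises to everyone but do not count as early neighbours.
\<close>

definition rich :: "('a \<Rightarrow> 'a set) \<Rightarrow> 'a set \<Rightarrow> 'a set \<Rightarrow> 'a rel \<Rightarrow> ('a \<Rightarrow> 'a) \<Rightarrow> 'a \<Rightarrow> bool" where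
  "rich N F U R f w \<longleftrightarrow>
     |N w \<inter> U| \<le>o |{u \<in> N w \<inter> U. f u = w \<and> (u \<in> F \<or> (w, u) \<in> R)}| \<or>
     |N w \<inter> U| \<le>o |{u \<in> N w \<inter> U - F. (u, w) \<in> R}|"

lemma countable_iff_card_of_nat: "countable A \<longleftrightarrow> |A| \<le>o |UNIV :: nat set|"
  unfolding countable_def card_of_ordLeq[symmetric] by simp

text \<open>Each vertex of infinite degree is served infinitely often, each time by a fresh
  neighbour whose index exceeds its own; that neighbour promises to avoid its colour.
  \<open>R\<close> compares indices. In a countable set, infinitely many such neighbours are as many
  as the whole neighbourhood.\<close>

lemma rich_countable:
  fixes U :: "'a set"
  assumes "countable U"
  shows "\<exists>R f. wf R \<and> (\<forall>w\<in>U. infinite (N w \<inter> U) \<longrightarrow> rich N F U R f w)"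
proof -
  define W where "W = {w \<in> U. infinite (N w \<inter> U)}"
  obtain i :: "'a \<Rightarrow> nat" where i: "inj_on i U"
    using assms countableE by blast
  show ?thesis
  proof (cases "W = {}")
    case True
    then show ?thesis
      unfolding W_def by (intro exI[of _ "{}"]) auto
  next
    case False
    \<comment> \<open>Decoding pairs makes the sequence visit every element of \<open>W\<close>
      infinitely often.\<close>
    define v where "v = (\<lambda>n. from_nat_into W (fst (prod_decode n)))"
    have cW: "countable W"
      using assms unfolding W_def by simp
    have vW: "v n \<in> W" for n
      unfolding v_def using from_nat_into[OF False] .
    have beyond: "\<exists>u \<in> N w \<inter> U. m < i u" if "w \<in> W" for w m
    proof (rule ccontr)
      assume "\<not> ?thesis"
      then have "i ` (N w \<inter> U) \<subseteq> {..m}" by (auto simp: not_less)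
      then have "finite (N w \<inter> U)"
        using i by (meson finite_atMost finite_imageD finite_subset inf_le2 inj_on_subset)
      then show False using that unfolding W_def by simp
    qed
    have "\<exists>u. \<forall>n. (u n \<in> N (v n) \<inter> U \<and> i (v n) < i (u n)) \<and> i (u n) < i (u (Suc n))"
    proof (rule dependent_nat_choice)
      show "\<exists>x. x \<in> N (v 0) \<inter> U \<and> i (v 0) < i x"
        using beyond[OF vW] by blast
      show "\<exists>y. (y \<in> N (v (Suc n)) \<inter> U \<and> i (v (Suc n)) < i y) \<and> i x < i y" for x n
        using beyond[OF vW[of "Suc n"], of "max (i (v (Suc n))) (i x)"] by auto
    qed
    then obtain u where u: "\<And>n. u n \<in> N (v n) \<inter> U" "\<And>n. i (v n) < i (u n)"
      and inc: "\<And>n. i (u n) < i (u (Suc n))" by blast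
    have "strict_mono (\<lambda>n. i (u n))"
      using inc by (simp add: strict_mono_Suc_iff)
    then have inju: "inj u"
      using strict_mono_eq[of "\<lambda>n. i (u n)"] by (metis injI)
    define f where "f = (\<lambda>x. v (inv u x))"
    define R where "R = inv_image less_than i"
    have "rich N F U R f w" if w: "w \<in> W" for w
    proof -
      obtain k where k: "from_nat_into W k = w"
        using from_nat_into_surj[OF cW w] by blast
      define S where "S = (\<lambda>m. u (prod_encode (k, m))) ` UNIV"
      have "inj (\<lambda>m. u (prod_encode (k, m)))"
        using inj_compose[OF inju, of "\<lambda>m. prod_encode (k, m)"] by (simp add: inj_on_def comp_def)
      then have "infinite S"
        unfolding S_def using range_inj_infinite by blast
      moreover have "countable (N w \<inter> U)"
        using assms by simp
      ultimately have "|N w \<inter> U| \<le>o |S|"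
        unfolding countable_iff_card_of_nat infinite_iff_card_of_nat by (rule ordLeq_transitive[rotated])
      moreover have "S \<subseteq> {u \<in> N w \<inter> U. f u = w \<and> (u \<in> F \<or> (w, u) \<in> R)}"
      proof
        fix x assume "x \<in> S"
        then obtain n where n: "x = u n" "v n = w"
          unfolding S_def v_def using k by auto
        then show "x \<in> {u \<in> N w \<inter> U. f u = w \<and> (u \<in> F \<or> (w, u) \<in> R)}"
          using u(1)[of n] u(2)[of n] inju unfolding f_def R_def by auto
      qed
      ultimately show ?thesis
        unfolding rich_def using card_of_mono1 ordLeq_transitive by blast
    qed
    moreover have "wf R"
      unfolding R_def by simp
    ultimately show ?thesis
      unfolding W_def by blast
  qed
qed

text \<open>A minimal element of \<open>Q\<close> is found in two steps: first a minimal block that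
  meets \<open>Q\<close>, then a minimal element of \<open>Q\<close> inside it.\<close>

lemma wf_blocks:
  fixes bl :: "'a \<Rightarrow> 'b"
  assumes lx: "wf lx" and R: "\<And>j. wf (R j)"
  shows "wf {(x, y). (bl x, bl y) \<in> lx \<or> bl x = bl y \<and> (x, y) \<in> R (bl y)}"
proof (rule wfI_min)
  fix x :: 'a and Q assume "x \<in> Q"
  then obtain j where j: "j \<in> bl ` Q" and minj: "\<And>i. (i, j) \<in> lx \<Longrightarrow> i \<notin> bl ` Q"
    using wfE_min[OF lx, of "bl x" "bl ` Q"] by blast
  then obtain y where "y \<in> {y \<in> Q. bl y = j}" by blast
  then obtain z where z: "z \<in> {y \<in> Q. bl y = j}"
    and minz: "\<And>y. (y, z) \<in> R j \<Longrightarrow> y \<notin> {y \<in> Q. bl y = j}"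
    using wfE_min[OF R[of j], of y "{y \<in> Q. bl y = j}"] by blast
  show "\<exists>z\<in>Q. \<forall>y. (y, z) \<in> {(x, y). (bl x, bl y) \<in> lx \<or> bl x = bl y \<and> (x, y) \<in> R (bl y)} \<longrightarrow> y \<notin> Q"
    using z minz minj by (intro bexI[of _ z]) auto
qed

text \<open>A vertex belongs to the block of the first stage that contains it. \<open>R\<close>
  compares blocks first, and inside a block it is the relation supplied by the induction on
  \<open>|U|\<close>.\<close>

lemma exists_rich_order:
  fixes U :: "'a set"
  assumes sym: "\<And>x y. y \<in> N x \<Longrightarrow> x \<in> N y" and F: "\<And>z. z \<in> F \<Longrightarrow> finite (N z)"
  shows "\<exists>R f. wf R \<and> (\<forall>w\<in>U. infinite (N w \<inter> U) \<longrightarrow> rich N F U R f w)"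
proof (induction U rule: wf_induct_rule[OF wf_inv_image[OF wf_ordLess, of card_of]])
  case (1 U)
  show ?case
  proof (cases "countable U")
    case True
    then show ?thesis by (rule rich_countable)
  next
    case False
    then have unc: "|UNIV :: nat set| <o |U|"
      unfolding countable_iff_card_of_nat card_of_not_ordLeq .
    obtain lt :: "'a rel" and K :: "'a \<Rightarrow> ('a + nat) set" where
      wf: "wf lt" and tr: "trans lt" and sub: "lt \<subseteq> U \<times> U" and
      tot: "\<And>a b. a \<in> U \<Longrightarrow> b \<in> U \<Longrightarrow> (a, b) \<in> lt \<or> a = b \<or> (b, a) \<in> lt" and
      infK: "\<And>b. infinite (K b)" and KU: "\<And>b. b \<in> U \<Longrightarrow> |K b| <o |U|" and
      segK: "\<And>b. |{a. (a, b) \<in> lt}| \<le>o |K b|" and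
      Kmono: "\<And>a b. (a, b) \<in> lt \<Longrightarrow> |K a| \<le>o |K b|" and
      many: "\<And>b (Y :: 'a set). b \<in> U \<Longrightarrow> |Y| \<le>o |U| \<Longrightarrow> |K b| <o |Y| \<Longrightarrow>
       |Y| \<le>o |{c \<in> U. (b, c) \<in> lt \<and> |K c| <o |Y|}|"
      by (rule well_order_small_segments[OF unc], rule that)
    define M where "M = (\<lambda>x. N x \<inter> U)"
    have MU: "\<And>x. M x \<subseteq> U" unfolding M_def by simp
    obtain X :: "'a \<times> 'a \<Rightarrow> 'a set" and p :: "'a \<times> 'a \<Rightarrow> 'a" where
      bound: "\<And>b v. |X (b, v)| \<le>o |K b|" and
      dom: "\<And>x b v. x \<in> X (b, v) \<Longrightarrow> x \<in> U \<and> b \<in> U \<and> v \<in> U" and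
      self: "\<And>b. b \<in> U \<Longrightarrow> b \<in> X (b, b)" and
      closed: "\<And>x b v. x \<in> X (b, v) \<Longrightarrow> |M x| \<le>o |K b| \<Longrightarrow> M x \<subseteq> X (b, v)" and
      pick: "\<And>b v c w. w \<in> X (b, v) \<Longrightarrow> (b, c) \<in> lt \<Longrightarrow> |K c| <o |M w| \<Longrightarrow>
       p (c, w) \<in> M w \<inter> X (c, w) - \<Union> (X ` {j. (j, (c, w)) \<in> lt <*lex*> lt})"
      by (rule closed_filtration[where M = M, OF wf tr sub infK segK Kmono MU], assumption, rule that)
    define lx where "lx = lt <*lex*> lt"
    have wflx: "wf lx" unfolding lx_def using wf by (intro wf_lex_prod)
    have totlx: "(i, j) \<in> lx \<or> i = j \<or> (j, i) \<in> lx" if "x \<in> X i" "y \<in> X j" for i j x y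
    proof -
      obtain a b c d where ij: "i = (a, b)" "j = (c, d)" by fastforce
      then have "a \<in> U" "b \<in> U" "c \<in> U" "d \<in> U"
        using dom that by blast+
      then show ?thesis
        unfolding ij lx_def using tot[of a c] tot[of b d] by auto
    qed
    define bl where "bl = (\<lambda>x. SOME j. x \<in> X j \<and> (\<forall>i. (i, j) \<in> lx \<longrightarrow> x \<notin> X i))"
    have "x \<in> X (bl x) \<and> (\<forall>i. (i, bl x) \<in> lx \<longrightarrow> x \<notin> X i)" if xU: "x \<in> U" for x
      unfolding bl_def
    proof (rule someI_ex)
      obtain j where "j \<in> {j. x \<in> X j}" "\<And>i. (i, j) \<in> lx \<Longrightarrow> i \<notin> {j. x \<in> X j}"
        using wfE_min[OF wflx, of "(x, x)" "{j. x \<in> X j}"] self[OF xU] by auto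
      then show "\<exists>j. x \<in> X j \<and> (\<forall>i. (i, j) \<in> lx \<longrightarrow> x \<notin> X i)"
        by (intro exI[of _ j]) simp
    qed
    then have bl: "\<And>x. x \<in> U \<Longrightarrow> x \<in> X (bl x)"
      and bl_min: "\<And>x i. x \<in> U \<Longrightarrow> (i, bl x) \<in> lx \<Longrightarrow> x \<notin> X i"
      by blast+
    have bl_eq: "bl x = j" if "x \<in> X j" "\<And>i. (i, j) \<in> lx \<Longrightarrow> x \<notin> X i" for x j
    proof -
      have "x \<in> U" using that(1) dom by (cases j) blast
      then show ?thesis
        using totlx[OF bl[OF \<open>x \<in> U\<close>] that(1)] that(2) bl bl_min that(1) by blast
    qed
    define B where "B = (\<lambda>j. {x \<in> U. bl x = j})"
    have "\<exists>R f. wf R \<and> (\<forall>w\<in>B j. infinite (N w \<inter> B j) \<longrightarrow> rich N F (B j) R f w)" for j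
    proof -
      have "|B j| <o |U|"
      proof (cases "B j = {}")
        case True
        then show ?thesis
          using False card_of_not_ordLeq[of U "{}"] card_of_ordLeq_finite[of U "{}"] countable_finite by auto
      next
        case nonempty: False
        obtain b v where j: "j = (b, v)" by fastforce
        have "B j \<subseteq> X j" unfolding B_def using bl by blast
        moreover from this have "b \<in> U" using nonempty dom j by blast
        ultimately show ?thesis
          using ordLeq_ordLess_trans[OF ordLeq_transitive[OF card_of_mono1 bound] KU] j by simp
      qed
      then show ?thesis
        by (intro 1) simp
    qed
    then obtain Rj fj where wfRj: "\<And>j. wf (Rj j)"
      and richj: "\<And>j w. w \<in> B j \<Longrightarrow> infinite (N w \<inter> B j) \<Longrightarrow> rich N F (B j) (Rj j) (fj j) w"
      by metis
    define R where "R = {(x, y). (bl x, bl y) \<in> lx \<or> bl x = bl y \<and> (x, y) \<in> Rj (bl y)}"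
    \<comment> \<open>The vertex picked at stage \<open>(c, w)\<close>, if it lies in that block,
      makes its promise to \<open>w\<close>. This overrides the inductively given promise of at most
      one vertex per block.\<close>
    define f where "f = (\<lambda>x. if x = p (bl x) then snd (bl x) else fj (bl x) x)"
    have "wf R"
      unfolding R_def by (rule wf_blocks[OF wflx wfRj])
    moreover have "rich N F U R f w" if w: "w \<in> U" and inf: "infinite (N w \<inter> U)" for w
    proof -
      obtain b v where j: "bl w = (b, v)" by fastforce
      have wX: "w \<in> X (b, v)" using bl[OF w] j by simp
      then have bU: "b \<in> U" using dom by blast
      show ?thesis
      proof (cases "|M w| \<le>o |K b|")
        case True
        define Z where "Z = \<Union> (X ` {i. (i, (b, v)) \<in> lx})"
        define E where "E = {u \<in> N w \<inter> U - F. (u, w) \<in> R}"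
        have MX: "M w \<subseteq> X (b, v)"
          using closed[OF wX True] .
        have early: "M w \<inter> Z \<subseteq> E"
        proof
          fix z assume z: "z \<in> M w \<inter> Z"
          then obtain i where i: "z \<in> X i" "(i, (b, v)) \<in> lx"
            unfolding Z_def by blast
          have zU: "z \<in> U" using z MU by blast
          \<comment> \<open>A stage contains the finite neighbourhoods of all its elements. So an
            early neighbour of finite degree would drag \<open>w\<close> into a stage before its own
            block.\<close>
          have "z \<notin> F"
          proof
            assume "z \<in> F"
            then have "finite (M z)" unfolding M_def using F by blast
            obtain c d where cd: "i = (c, d)" by fastforce
            have "|M z| \<le>o |K c|"
              using \<open>finite (M z)\<close> infK[of c] card_of_not_ordLeq card_of_ordLeq_infinite
                ordLess_imp_ordLeq by blast
            then have "M z \<subseteq> X i"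
              using closed[of z c d] i cd by blast
            moreover have "w \<in> M z"
              using z w sym unfolding M_def by blast
            ultimately show False
              using bl_min[OF w, of i] i j by auto
          qed
          moreover have "(bl z, bl w) \<in> lx"
          proof -
            have "(bl z, i) \<in> lx \<or> bl z = i"
              using totlx[OF bl[OF zU] i(1)] bl_min[OF zU] i(1) by blast
            moreover have "trans lx"
              unfolding lx_def using tr by (intro trans_lex_prod)
            ultimately show ?thesis
              using i(2) j by (auto dest: transD)
          qed
          ultimately show "z \<in> E"
            using z zU unfolding E_def R_def M_def by blast
        qed
        have "M w \<inter> X (b, v) - Z \<subseteq> B (b, v)"
        proof
          fix z assume "z \<in> M w \<inter> X (b, v) - Z"
          then show "z \<in> B (b, v)"
            using bl_eq[of z "(b, v)"] MU unfolding B_def Z_def by blast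
        qed
        then have split: "M w \<subseteq> (M w \<inter> Z) \<union> (N w \<inter> B (b, v))"
          using MX unfolding M_def by blast
        show ?thesis
        proof (cases "|M w| \<le>o |M w \<inter> Z|")
          case True
          then have "|M w| \<le>o |E|"
            using early card_of_mono1 ordLeq_transitive by blast
          then show ?thesis
            unfolding rich_def E_def M_def ..
        next
          case False
          define S where "S = N w \<inter> B (b, v)"
          have MS: "|M w| \<le>o |S|"
          proof (rule ccontr)
            assume "\<not> |M w| \<le>o |S|"
            then have "|(M w \<inter> Z) \<union> S| <o |M w|"
              using False inf by (intro card_of_Un_ordLess_infinite) (auto simp: card_of_not_ordLeq M_def)
            then show False
              using split card_of_mono1 not_ordLess_ordLeq unfolding S_def by blast
          qed
          then have infS: "infinite S"
            using inf card_of_ordLeq_infinite unfolding M_def by blast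
          have wB: "w \<in> B (b, v)"
            unfolding B_def using w j by simp
          have BU: "B (b, v) \<subseteq> U"
            unfolding B_def by blast
          define A where "A = {u \<in> S. fj (b, v) u = w \<and> (u \<in> F \<or> (w, u) \<in> Rj (b, v))}"
          consider "|S| \<le>o |A|" | "|S| \<le>o |{u \<in> S - F. (u, w) \<in> Rj (b, v)}|"
            using richj[OF wB] infS unfolding rich_def S_def A_def by blast
          then show ?thesis
          proof cases
            case 1
            then have infA: "infinite A"
              using infS card_of_ordLeq_infinite by blast
            \<comment> \<open>Only \<open>p (b, v)\<close> may have had its promise overridden, and
              removing one element from an infinite set keeps its cardinality.\<close>
            have "|S| \<le>o |A - {p (b, v)}|"
              using 1 infinite_imp_bij_betw[OF infA, of "p (b, v)"] card_of_ordIso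
                ordLeq_ordIso_trans by blast
            moreover have "A - {p (b, v)} \<subseteq> {u \<in> N w \<inter> U. f u = w \<and> (u \<in> F \<or> (w, u) \<in> R)}"
              using BU j unfolding A_def S_def f_def R_def B_def by auto
            ultimately have "|M w| \<le>o |{u \<in> N w \<inter> U. f u = w \<and> (u \<in> F \<or> (w, u) \<in> R)}|"
              using ordLeq_transitive[OF MS] ordLeq_transitive card_of_mono1 by fast
            then show ?thesis
              unfolding rich_def M_def ..
          next
            case 2
            moreover have "{u \<in> S - F. (u, w) \<in> Rj (b, v)} \<subseteq> E"
              using j unfolding S_def E_def R_def B_def by auto
            ultimately have "|M w| \<le>o |E|"
              using ordLeq_transitive[OF MS] ordLeq_transitive card_of_mono1 by fast
            then show ?thesis
              unfolding rich_def E_def M_def ..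
          qed
        qed
      next
        case False
        then have big: "|K b| <o |M w|" by (simp add: card_of_not_ordLeq)
        define C where "C = {c \<in> U. (b, c) \<in> lt \<and> |K c| <o |M w|}"
        have "|M w| \<le>o |C|"
          unfolding C_def by (rule many[OF bU card_of_mono1[OF MU] big])
        define S where "S = {u \<in> N w \<inter> U. f u = w \<and> (u \<in> F \<or> (w, u) \<in> R)}"
        \<comment> \<open>The picked vertices lie in the different blocks \<open>(c, w)\<close>, so
          they are distinct, make their promise to \<open>w\<close>, and come after \<open>w\<close>
          in \<open>R\<close> because \<open>b\<close> precedes \<open>c\<close>.\<close>
        have pc: "p (c, w) \<in> M w" "bl (p (c, w)) = (c, w)" if "c \<in> C" for c
        proof -
          have *: "p (c, w) \<in> M w \<inter> X (c, w) - \<Union> (X ` {j. (j, (c, w)) \<in> lx})"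
            unfolding lx_def using pick[OF wX] that unfolding C_def by blast
          then show "p (c, w) \<in> M w" by blast
          show "bl (p (c, w)) = (c, w)"
            by (rule bl_eq) (use * in blast)+
        qed
        have "|C| \<le>o |S|"
        proof (rule card_of_ordLeqI)
          show "inj_on (\<lambda>c. p (c, w)) C"
            by (rule inj_onI) (metis pc(2) prod.inject)
          show "p (c, w) \<in> S" if "c \<in> C" for c
            using pc[OF that] that j MU unfolding S_def f_def R_def M_def lx_def C_def by auto
        qed
        then have "|M w| \<le>o |S|"
          by (rule ordLeq_transitive[OF \<open>|M w| \<le>o |C|\<close>])
        then show ?thesis
          unfolding rich_def S_def M_def ..
      qed
    qed
    ultimately show ?thesis by blast
  qed
qed

section \<open>Compactness, and majority colourings of finite sets of vertices\<close>

text \<open>By Tychonoff the product of the finite discrete lists is compact. Each condition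
  \<open>Q u\<close> reads only the finitely many coordinates in \<open>A u\<close>, so it cuts out
  a closed set, and the finite intersection property applies.\<close>

lemma compactness_finite_choices:
  fixes L :: "'a \<Rightarrow> 'c set" and Q :: "'a \<Rightarrow> ('a \<Rightarrow> 'c) \<Rightarrow> bool"
  assumes fin: "\<And>x. x \<in> F \<Longrightarrow> finite (L x)"
    and loc: "\<And>u. u \<in> F \<Longrightarrow> finite (A u) \<and> A u \<subseteq> F"
    and cong: "\<And>u h h'. u \<in> F \<Longrightarrow> (\<And>x. x \<in> A u \<Longrightarrow> h x = h' x) \<Longrightarrow> Q u h \<Longrightarrow> Q u h'"
    and fip: "\<And>D. finite D \<Longrightarrow> D \<subseteq> F \<Longrightarrow> \<exists>h. (\<forall>x\<in>F. h x \<in> L x) \<and> (\<forall>u\<in>D. Q u h)"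
  shows "\<exists>h. (\<forall>x\<in>F. h x \<in> L x) \<and> (\<forall>u\<in>F. Q u h)"
proof (cases "F = {}")
  case True
  then show ?thesis by simp
next
  case False
  define T where "T = product_topology (\<lambda>x. discrete_topology (L x)) F"
  define C where "C = (\<lambda>u. {h \<in> Pi\<^sub>E F L. Q u h})"
  have topT: "topspace T = Pi\<^sub>E F L"
    unfolding T_def by simp
  have "compact_space T"
    unfolding T_def using fin
    by (simp add: compact_space_product_topology compact_space_discrete_topology)
  moreover have "closedin T (C u)" if u: "u \<in> F" for u
  proof -
    have "openin T (Pi\<^sub>E F L - C u)"
    proof (subst openin_subopen, intro ballI)
      fix h assume h: "h \<in> Pi\<^sub>E F L - C u"
      define W where "W = Pi\<^sub>E F (\<lambda>x. if x \<in> A u then {h x} else L x)"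
      have "openin T W"
        unfolding T_def W_def
      proof (rule product_topology_basis)
        show "openin (discrete_topology (L x)) (if x \<in> A u then {h x} else L x)" for x
          using h loc[OF u] by (auto simp: PiE_iff)
        show "finite {i. (if i \<in> A u then {h i} else L i) \<noteq> topspace (discrete_topology (L i))}"
          using loc[OF u] by (auto intro: finite_subset)
      qed
      moreover have "h \<in> W"
        using h unfolding W_def by (auto simp: PiE_iff)
      moreover have "W \<subseteq> Pi\<^sub>E F L - C u"
      proof
        fix h' assume h': "h' \<in> W"
        have eq: "h' x = h x" if "x \<in> A u" for x
          using PiE_mem[OF h'[unfolded W_def], of x] that loc[OF u] by auto
        moreover have "h' \<in> Pi\<^sub>E F L"
          using h' h unfolding W_def by (auto simp: PiE_iff split: if_splits)
        ultimately show "h' \<in> Pi\<^sub>E F L - C u"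
          using h cong[OF u, of h' h] unfolding C_def by auto
      qed
      ultimately show "\<exists>W. openin T W \<and> h \<in> W \<and> W \<subseteq> Pi\<^sub>E F L - C u"
        by blast
    qed
    then show ?thesis
      unfolding closedin_def topT C_def by auto
  qed
  moreover have "\<Inter> \<F> \<noteq> {}" if fam: "finite \<F>" "\<F> \<subseteq> C ` F" for \<F>
  proof -
    obtain D where D: "finite D" "D \<subseteq> F" "\<F> = C ` D"
      using finite_subset_image[OF fam] by blast
    then obtain h where h: "\<forall>x\<in>F. h x \<in> L x" "\<forall>u\<in>D. Q u h"
      using fip by blast
    have "restrict h F \<in> C u" if "u \<in> D" for u
    proof -
      have u: "u \<in> F" using that D(2) by blast
      have "Q u (restrict h F)"
        by (rule cong[OF u, of h]) (use h that loc[OF u] in auto)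
      then show ?thesis
        using h(1) unfolding C_def by auto
    qed
    then show ?thesis
      unfolding D(3) by blast
  qed
  ultimately have "\<Inter> (C ` F) \<noteq> {}"
    unfolding compact_space_fip by blast
  then obtain h where "\<forall>u\<in>F. h \<in> C u" by blast
  then show ?thesis
    using False unfolding C_def by (intro exI[of _ h]) (auto simp: PiE_iff)
qed

text \<open>A colouring with fewest monochromatic edges works: giving \<open>u\<close> another
  colour \<open>c\<close> of its list trades the monochromatic edges at \<open>u\<close> for those
  to neighbours coloured \<open>c\<close>, whose colour differs from \<open>h u\<close>.\<close>

lemma finite_majority:
  fixes N :: "'a \<Rightarrow> 'a set" and L :: "'a \<Rightarrow> 'c set"
  assumes sym: "\<And>x y. y \<in> N x \<Longrightarrow> x \<in> N y" and irr: "\<And>x. x \<notin> N x"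
    and fin: "finite D" "\<And>u. u \<in> D \<Longrightarrow> finite (N u)"
    and L: "\<And>u c. u \<in> D \<Longrightarrow> L u - {c} \<noteq> {}"
  shows "\<exists>h. (\<forall>x. x \<notin> D \<longrightarrow> h x = g x) \<and> (\<forall>u\<in>D. h u \<in> L u) \<and>
    (\<forall>u\<in>D. card {x \<in> N u. h x = h u} \<le> card {x \<in> N u. h x \<noteq> h u})"
proof -
  define P where "P = (\<lambda>h. (\<forall>x. x \<notin> D \<longrightarrow> h x = g x) \<and> (\<forall>u\<in>D. h u \<in> L u))"
  \<comment> \<open>Only edges that meet \<open>D\<close> are counted: they are finitely many, and
    recolouring inside \<open>D\<close> affects no others.\<close>
  define E where "E = (\<Union>u\<in>D. (\<lambda>x. {u, x}) ` N u)"
  define mono_edges where "mono_edges = (\<lambda>h :: 'a \<Rightarrow> 'c. {e \<in> E. \<forall>x\<in>e. \<forall>y\<in>e. h x = h y})"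
  have "P (\<lambda>x. if x \<in> D then SOME c. c \<in> L x else g x)"
    unfolding P_def using L by (auto simp: some_in_eq)
  then obtain h where h: "P h" and least: "\<And>h'. P h' \<Longrightarrow> card (mono_edges h) \<le> card (mono_edges h')"
    using ex_has_least_nat[of P _ "\<lambda>h. card (mono_edges h)"] by blast
  have finE: "finite E"
    unfolding E_def using fin by blast
  have card_split: "card (mono_edges h) = card {e \<in> mono_edges h. u \<notin> e} + card {x \<in> N u. h x = h u}"
    if u: "u \<in> D" for u h
  proof -
    have "mono_edges h = {e \<in> mono_edges h. u \<notin> e} \<union> (\<lambda>x. {u, x}) ` {x \<in> N u. h x = h u}"
    proof (intro equalityI subsetI)
      fix e assume e: "e \<in> mono_edges h"
      show "e \<in> {e \<in> mono_edges h. u \<notin> e} \<union> (\<lambda>x. {u, x}) ` {x \<in> N u. h x = h u}"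
      proof (cases "u \<in> e")
        case True
        obtain v x where vx: "e = {v, x}" "x \<in> N v"
          using e unfolding mono_edges_def E_def by blast
        then have "\<exists>y\<in>N u. e = {u, y}"
        proof (cases "u = v")
          case False
          then have "u = x" using True vx(1) by simp
          then have "v \<in> N u" "e = {u, v}"
            using sym[OF vx(2)] vx(1) by (simp_all add: insert_commute)
          then show ?thesis by blast
        qed (use vx in blast)
        then obtain x where x: "x \<in> N u" "e = {u, x}" ..
        then have "h x = h u"
          using e unfolding mono_edges_def by blast
        then show ?thesis
          using x by blast
      next
        case False
        then show ?thesis using e by blast
      qed
    next
      fix e assume "e \<in> {e \<in> mono_edges h. u \<notin> e} \<union> (\<lambda>x. {u, x}) ` {x \<in> N u. h x = h u}"
      then show "e \<in> mono_edges h"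
        unfolding mono_edges_def E_def using u by auto
    qed
    moreover have "card ((\<lambda>x. {u, x}) ` {x \<in> N u. h x = h u}) = card {x \<in> N u. h x = h u}"
      using irr by (intro card_image inj_onI) (auto simp: doubleton_eq_iff)
    moreover have "finite (mono_edges h)"
      unfolding mono_edges_def using finE by simp
    ultimately show ?thesis
      using fin(2)[OF u] card_Un_disjoint[of "{e \<in> mono_edges h. u \<notin> e}" "(\<lambda>x. {u, x}) ` {x \<in> N u. h x = h u}"]
      by (auto simp: disjoint_iff)
  qed
  have "card {x \<in> N u. h x = h u} \<le> card {x \<in> N u. h x \<noteq> h u}" if u: "u \<in> D" for u
  proof -
    obtain c where c: "c \<in> L u" "c \<noteq> h u"
      using L[OF u, of "h u"] by blast
    let ?h = "h(u := c)"
    have eq: "{e \<in> mono_edges ?h. u \<notin> e} = {e \<in> mono_edges h. u \<notin> e}"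
      unfolding mono_edges_def by (auto simp: fun_upd_def)
    have "card {e \<in> mono_edges h. u \<notin> e} + card {x \<in> N u. h x = h u} = card (mono_edges h)"
      by (rule card_split[OF u, symmetric])
    also have "\<dots> \<le> card (mono_edges ?h)"
      using h c u by (intro least) (auto simp: P_def)
    also have "\<dots> = card {e \<in> mono_edges h. u \<notin> e} + card {x \<in> N u. ?h x = ?h u}"
      unfolding eq[symmetric] by (rule card_split[OF u])
    finally have "card {x \<in> N u. h x = h u} \<le> card {x \<in> N u. ?h x = ?h u}"
      by (simp only: add_le_cancel_left)
    also have "\<dots> \<le> card {x \<in> N u. h x \<noteq> h u}"
      using fin(2)[OF u] irr[of u] c by (intro card_mono) auto
    finally show ?thesis .
  qed
  then show ?thesis
    using h unfolding P_def by blast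
qed

section \<open>Greedy colouring at infinite degree\<close>

text \<open>Avoiding one colour for \<open>f w\<close> leaves two. They cannot both fail: otherwise
  \<open>A w\<close> would be a union of two sets smaller than the infinite set
  \<open>N w\<close>.\<close>

lemma greedy_colouring:
  fixes N :: "'a \<Rightarrow> 'a set" and L :: "'a \<Rightarrow> 'c set"
  assumes wf: "wf R" and inf: "\<And>w. w \<in> I \<Longrightarrow> infinite (N w)"
    and L: "\<And>w. w \<in> I \<Longrightarrow> finite (L w) \<and> card (L w) = 3"
    and A: "\<And>u w. u \<in> A w \<Longrightarrow> (u, w) \<in> R"
  shows "\<exists>g. \<forall>w\<in>I. g w \<in> L w \<and> ((f w, w) \<in> R \<longrightarrow> g w \<noteq> g (f w)) \<and>
    ( |N w| \<le>o |A w| \<longrightarrow> |N w| \<le>o |{u \<in> A w. g u \<noteq> g w}| )"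
proof -
  \<comment> \<open>The colour \<open>g (f w)\<close> is excluded unconditionally. If
    \<open>f w\<close> does not precede \<open>w\<close>, the recursion sees an arbitrary value
    there, and still at most one colour is lost.\<close>
  define P where "P = (\<lambda>g w c. c \<in> L w \<and> c \<noteq> g (f w) \<and>
    ( |N w| \<le>o |A w| \<longrightarrow> |N w| \<le>o |{u \<in> A w. g u \<noteq> c}| ))"
  have ex: "\<exists>c. P g w c" if w: "w \<in> I" for g w
  proof (rule ccontr)
    assume none: "\<nexists>c. P g w c"
    have "2 \<le> card (L w - {g (f w)})"
      using L[OF w] by (simp add: card_Diff_singleton_if)
    then obtain a b where ab: "a \<in> L w - {g (f w)}" "b \<in> L w - {g (f w)}" "a \<noteq> b"
      by (auto simp: numeral_2_eq_2 card_le_Suc_iff)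
    let ?A = "{u \<in> A w. g u \<noteq> a}" and ?B = "{u \<in> A w. g u \<noteq> b}"
    have "|N w| \<le>o |A w|" "|?A| <o |N w|" "|?B| <o |N w|"
      using none ab unfolding P_def by (auto simp: card_of_not_ordLeq)
    moreover have "A w = ?A \<union> ?B" using ab(3) by auto
    ultimately show False
      using card_of_Un_ordLess_infinite[OF inf[OF w], of ?A ?B] not_ordLess_ordLeq by metis
  qed
  define g where "g = wfrec R (\<lambda>g w. SOME c. P g w c)"
  have P: "P (cut g R w) w (g w)" if "w \<in> I" for w
    using someI_ex[OF ex[OF that, of "cut g R w"]] wfrec[OF wf, of "\<lambda>g w. SOME c. P g w c" w]
    unfolding g_def by simp
  have cut_A: "{u \<in> A w. cut g R w u \<noteq> c} = {u \<in> A w. g u \<noteq> c}" for w c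
    using A by (auto simp: cut_apply)
  show ?thesis
  proof (intro exI[of _ g] ballI conjI)
    fix w assume "w \<in> I"
    note Pw = P[OF this, unfolded P_def cut_A]
    show "g w \<in> L w" "|N w| \<le>o |A w| \<longrightarrow> |N w| \<le>o |{u \<in> A w. g u \<noteq> g w}|"
      using Pw by blast+
    show "(f w, w) \<in> R \<longrightarrow> g w \<noteq> g (f w)"
      using Pw cut_apply[of "f w" w R g] by metis
  qed
qed

section \<open>Extending a fixed colouring to all vertices of finite degree\<close>

lemma card_of_filter_eq_lepoll:
  assumes "|A| \<le>o |{u \<in> A. P u}|"
  shows "{u \<in> A. \<not> P u} \<lesssim> {u \<in> A. P u}"
proof -
  have "|{u \<in> A. \<not> P u}| \<le>o |{u \<in> A. P u}|"
    by (rule ordLeq_transitive[OF card_of_mono1 assms]) blast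
  then show ?thesis
    unfolding card_of_ordLeq[symmetric] lepoll_def .
qed

text \<open>At a vertex of finite degree the majority condition involves finitely many vertices, so
  compactness reduces the claim to finite subsets of \<open>F\<close>.\<close>

lemma locally_finite_majority:
  fixes N :: "'a \<Rightarrow> 'a set" and L :: "'a \<Rightarrow> 'c set"
  assumes sym: "\<And>x y. y \<in> N x \<Longrightarrow> x \<in> N y" and irr: "\<And>x. x \<notin> N x"
    and finN: "\<And>u. u \<in> F \<Longrightarrow> finite (N u)"
    and finL: "\<And>u. u \<in> F \<Longrightarrow> finite (L u)" and L: "\<And>u c. u \<in> F \<Longrightarrow> L u - {c} \<noteq> {}"
  shows "\<exists>h. (\<forall>x. x \<notin> F \<longrightarrow> h x = g x) \<and> (\<forall>u\<in>F. h u \<in> L u) \<and>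
    (\<forall>u\<in>F. card {x \<in> N u. h x = h u} \<le> card {x \<in> N u. h x \<noteq> h u})"
proof -
  \<comment> \<open>Outside \<open>F\<close> the colours are frozen to \<open>g\<close>, so that
    \<open>Q u\<close> depends on \<open>h\<close> only through its values on
    \<open>F\<close>.\<close>
  define ext where "ext = (\<lambda>h x. if x \<in> F then h x else g x)"
  define Q where "Q = (\<lambda>u h. card {x \<in> N u. ext h x = ext h u} \<le> card {x \<in> N u. ext h x \<noteq> ext h u})"
  have "\<exists>h. (\<forall>x\<in>F. h x \<in> L x) \<and> (\<forall>u\<in>F. Q u h)"
  proof (rule compactness_finite_choices[where A = "\<lambda>u. insert u (N u) \<inter> F"])
    show "finite (L x)" if "x \<in> F" for x
      by (rule finL[OF that])
    show "finite (insert u (N u) \<inter> F) \<and> insert u (N u) \<inter> F \<subseteq> F" if "u \<in> F" for u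
      using finN[OF that] by simp
    show "Q u h'" if "u \<in> F" "\<And>x. x \<in> insert u (N u) \<inter> F \<Longrightarrow> h x = h' x" "Q u h" for u h h'
    proof -
      have "ext h x = ext h' x" if "x \<in> insert u (N u)" for x
        using that \<open>\<And>x. x \<in> insert u (N u) \<inter> F \<Longrightarrow> h x = h' x\<close>[of x] unfolding ext_def by auto
      then have "{x \<in> N u. ext h x = ext h u} = {x \<in> N u. ext h' x = ext h' u}"
        "{x \<in> N u. ext h x \<noteq> ext h u} = {x \<in> N u. ext h' x \<noteq> ext h' u}"
        by auto
      then show ?thesis
        using \<open>Q u h\<close> unfolding Q_def by simp
    qed
    show "\<exists>h. (\<forall>x\<in>F. h x \<in> L x) \<and> (\<forall>u\<in>D. Q u h)" if D: "finite D" "D \<subseteq> F" for D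
    proof -
      \<comment> \<open>Vertices of \<open>F\<close> outside \<open>D\<close> keep an arbitrary
        colour from their lists.\<close>
      define g' where "g' = ext (\<lambda>x. SOME c. c \<in> L x)"
      have g': "g' x \<in> L x" if "x \<in> F" for x
        using L[OF that] that unfolding g'_def ext_def by (auto simp: some_in_eq)
      obtain h where h: "\<forall>x. x \<notin> D \<longrightarrow> h x = g' x" "\<forall>u\<in>D. h u \<in> L u"
        "\<forall>u\<in>D. card {x \<in> N u. h x = h u} \<le> card {x \<in> N u. h x \<noteq> h u}"
        using finite_majority[where N = N and L = L and D = D and g = g', OF sym irr D(1)] D(2) finN L
        by blast
      have "ext h = h"
        using h(1) D(2) unfolding g'_def ext_def by (auto simp: fun_eq_iff)
      moreover have "h x \<in> L x" if "x \<in> F" for x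
        using h(1,2) g'[OF that] by (cases "x \<in> D") auto
      ultimately show ?thesis
        using h(3) unfolding Q_def by (intro exI[of _ h]) auto
    qed
  qed
  then obtain h where h: "\<forall>x\<in>F. h x \<in> L x" "\<forall>u\<in>F. Q u h" by blast
  show ?thesis
    by (rule exI[of _ "ext h"]) (use h in \<open>auto simp: ext_def Q_def\<close>)
qed

section \<open>Majority colourings of arbitrary graphs from lists of three colours\<close>

theorem theorem1:
  fixes V :: "'a set" and E :: "'a set set"
  assumes "simple_graph V E"
  shows "majority_choosable TYPE('c) 3 V E"
  unfolding majority_choosable_def
proof (intro allI impI)
  fix L :: "'a \<Rightarrow> 'c set"
  assume L: "\<forall>v\<in>V. finite (L v) \<and> card (L v) = 3"
  define N where "N = neighbours E"
  define F where "F = {v \<in> V. finite (N v)}"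
  have sym: "\<And>x y. y \<in> N x \<Longrightarrow> x \<in> N y"
    unfolding N_def neighbours_def by (simp add: insert_commute)
  have irr: "\<And>x. x \<notin> N x"
    using assms unfolding N_def neighbours_def simple_graph_def by auto
  have NV: "N v \<inter> V = N v" for v
    using assms unfolding N_def neighbours_def simple_graph_def by auto
  have finF: "\<And>z. z \<in> F \<Longrightarrow> finite (N z)" and FV: "F \<subseteq> V"
    unfolding F_def by auto
  obtain R f where wf: "wf R" and rich: "\<And>w. w \<in> V - F \<Longrightarrow> rich N F V R f w"
    using exists_rich_order[of N F V, OF sym finF] unfolding F_def by (auto simp: NV)
  define A where "A = (\<lambda>w. {u \<in> N w - F. (u, w) \<in> R})"
  have "\<exists>g. \<forall>w\<in>V - F. g w \<in> L w \<and> ((f w, w) \<in> R \<longrightarrow> g w \<noteq> g (f w)) \<and>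
    ( |N w| \<le>o |A w| \<longrightarrow> |N w| \<le>o |{u \<in> A w. g u \<noteq> g w}| )"
    by (rule greedy_colouring[OF wf]) (use L in \<open>auto simp: F_def A_def\<close>)
  then obtain g where gL: "\<And>w. w \<in> V - F \<Longrightarrow> g w \<in> L w"
    and gf: "\<And>w. w \<in> V - F \<Longrightarrow> (f w, w) \<in> R \<Longrightarrow> g w \<noteq> g (f w)"
    and gA: "\<And>w. w \<in> V - F \<Longrightarrow> |N w| \<le>o |A w| \<Longrightarrow> |N w| \<le>o |{u \<in> A w. g u \<noteq> g w}|"
    by blast
  \<comment> \<open>For \<open>f u\<close> outside \<open>F\<close>, \<open>g (f u)\<close> is its
    final colour, so the promise of \<open>u\<close> is kept; for \<open>f u\<close> in
    \<open>F\<close> an arbitrary value is dropped. Either way at least two colours remain.\<close>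
  have "\<exists>h. (\<forall>x. x \<notin> F \<longrightarrow> h x = g x) \<and> (\<forall>u\<in>F. h u \<in> L u - {g (f u)}) \<and>
    (\<forall>u\<in>F. card {x \<in> N u. h x = h u} \<le> card {x \<in> N u. h x \<noteq> h u})"
  proof (rule locally_finite_majority[OF sym irr finF])
    show "finite (L u - {g (f u)})" if "u \<in> F" for u
      using L FV that by auto
    show "L u - {g (f u)} - {c} \<noteq> {}" if "u \<in> F" for u c
    proof
      assume "L u - {g (f u)} - {c} = {}"
      then have "L u \<subseteq> {g (f u), c}" by blast
      then have "card (L u) \<le> card {g (f u), c}"
        by (intro card_mono) auto
      also have "\<dots> \<le> 2" by (simp add: card_insert_if)
      finally show False using L FV that by auto
    qed
  qed
  then obtain h where hg: "\<And>x. x \<notin> F \<Longrightarrow> h x = g x" and hL: "\<And>u. u \<in> F \<Longrightarrow> h u \<in> L u - {g (f u)}"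
    and hF: "\<And>u. u \<in> F \<Longrightarrow> card {x \<in> N u. h x = h u} \<le> card {x \<in> N u. h x \<noteq> h u}"
    by blast
  have "{u \<in> N v. h u = h v} \<lesssim> {u \<in> N v. h u \<noteq> h v}" if v: "v \<in> V" for v
  proof (cases "v \<in> F")
    case True
    then show ?thesis
      using hF[OF True] finF[OF True] by (simp add: lepoll_iff_card_le)
  next
    case False
    then have vI: "v \<in> V - F" using v by blast
    have "|N v| \<le>o |{u \<in> N v. h u \<noteq> h v}|"
      using rich[OF vI] unfolding rich_def NV
    proof
      assume le: "|N v| \<le>o |{u \<in> N v. f u = v \<and> (u \<in> F \<or> (v, u) \<in> R)}|"
      \<comment> \<open>Promises to \<open>v\<close> are kept by the shortened lists when
        \<open>u\<close> is in \<open>F\<close>, and by the greedy choice at \<open>u\<close> when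
        \<open>u\<close> comes after \<open>v\<close>.\<close>
      have "{u \<in> N v. f u = v \<and> (u \<in> F \<or> (v, u) \<in> R)} \<subseteq> {u \<in> N v. h u \<noteq> h v}"
      proof
        fix u assume u: "u \<in> {u \<in> N v. f u = v \<and> (u \<in> F \<or> (v, u) \<in> R)}"
        have "h u \<noteq> h v"
        proof (cases "u \<in> F")
          case True
          then show ?thesis
            using hL[OF True] hg[OF False] u by auto
        next
          case uF: False
          then have "u \<in> V - F" using u NV[of v] by blast
          then show ?thesis
            using gf[of u] hg[OF False] hg[OF uF] u uF by auto
        qed
        then show "u \<in> {u \<in> N v. h u \<noteq> h v}" using u by blast
      qed
      then show ?thesis
        by (rule ordLeq_transitive[OF le card_of_mono1])
    next
      assume "|N v| \<le>o |{u \<in> N v - F. (u, v) \<in> R}|"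
      then have "|N v| \<le>o |{u \<in> A v. g u \<noteq> g v}|"
        using gA[OF vI] unfolding A_def by blast
      then show ?thesis
        by (rule ordLeq_transitive[OF _ card_of_mono1]) (use hg False in \<open>auto simp: A_def\<close>)
    qed
    from card_of_filter_eq_lepoll[OF this] show ?thesis by simp
  qed
  then have "majority_colouring V E h"
    unfolding majority_colouring_def N_def by blast
  moreover have "h v \<in> L v" if "v \<in> V" for v
    using hL[of v] hg[of v] gL[of v] that by (cases "v \<in> F") auto
  ultimately show "\<exists>g. majority_colouring V E g \<and> (\<forall>v\<in>V. g v \<in> L v)"
    by blast
qed

end
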